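(* Let $(V,\omega)$ be a real symplectic vector space with $\dim V=2n$, and let $\Lambda$ be its Lagrangian Grassmannian. For every continuous curve $\ell:[a,b]\to\Lambda$ and every pair of Lagrangians $L_0,L_1\in\Lambda$, $$\big|\mu_{L_0}(\ell)-\mu_{L_1}(\ell)\big|\le n-\dim(L_0\cap L_1).$$
   Context: $\Lambda$ is the set of all Lagrangian ($n$-dimensional isotropic) subspaces of $(V,\omega)$, a compact manifold of dimension $\frac12 n(n+1)$. For $L_1\in\Lambda$, $\Lambda^0(L_1)$ denotes the open set of Lagrangians transverse to $L_1$. If $L_0,L_1\in\Lambda$ are transverse, so that $V=L_0\oplus L_1$, the chart $\varphi_{L_0,L_1}$ from $\Lambda^0(L_1)$ to the space $\mathrm{B}_{\mathrm{sym}}(L_0)$ of symmetric bilinear forms on $L_0$ is defined by $\varphi_{L_0,L_1}(L)=\omega(T\cdot,\cdot)|_{L_0\times L_0}$, where $T:L_0\to L_1$ is the unique linear map whose graph in $L_0\oplus L_1=V$ is $L$. For a symmetric bilinear form $B$, the index $n_-(B)$ is the dimension of a maximal subspace on which $B$ is negative definite, and the coindex is $n_+(B)=n_-(-B)$. For $L_0\in\Lambda$ and a continuous path $\ell:[a,b]\to\Lambda$, the $L_0$-Maslov index $\mu_{L_0}(\ell)\in\mathbb Z$ is the integer characterized by: (a) $\mu_{L_0}$ is invariant under fixed-endpoint homotopies; (b) $\mu_{L_0}$ is additive under concatenation; (c) if $\ell([a,b])\subset\Lambda^0(L_1)$ for some Lagrangian $L_1$ transverse to $L_0$, then $\mu_{L_0}(\ell)=n_+[\varphi_{L_0,L_1}(\ell(b))]-n_+[\varphi_{L_0,L_1}(\ell(a))]$.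 *)

theory Defs
  imports "HOL-Analysis.Analysis"
begin

text \<open>
  The symplectic vector space is the whole type \<open>'a::euclidean_space\<close>; the class only
  supplies finite dimension, and no definition below uses its inner product or norm.
\<close>

definition symplectic_form :: "('a::euclidean_space \<Rightarrow> 'a \<Rightarrow> real) \<Rightarrow> bool" where
  "symplectic_form \<omega> \<longleftrightarrow>
     bilinear \<omega> \<and> (\<forall>x. \<omega> x x = 0) \<and> (\<forall>x. (\<forall>y. \<omega> x y = 0) \<longrightarrow> x = 0)"

definition lagrangian :: "('a::euclidean_space \<Rightarrow> 'a \<Rightarrow> real) \<Rightarrow> 'a set \<Rightarrow> bool" where
  "lagrangian \<omega> L \<longleftrightarrow>
     subspace L \<and> 2 * dim L = DIM('a) \<and> (\<forall>x\<in>L. \<forall>y\<in>L. \<omega> x y = 0)"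

definition transverse_lagrangians ::
    "('a::euclidean_space \<Rightarrow> 'a \<Rightarrow> real) \<Rightarrow> 'a set \<Rightarrow> 'a set set" where
  "transverse_lagrangians \<omega> L1 = {L. lagrangian \<omega> L \<and> L \<inter> L1 = {0}}"

text \<open>
  The linear map \<open>T : L0 \<rightarrow> L1\<close> whose graph in \<open>L0 \<oplus> L1\<close> is \<open>L\<close>. A map on \<open>L0\<close> is a
  function that is \<open>undefined\<close> outside \<open>L0\<close>, so that \<open>T\<close> is unique.
\<close>

definition graph_map ::
    "'a::euclidean_space set \<Rightarrow> 'a set \<Rightarrow> 'a set \<Rightarrow> 'a \<Rightarrow> 'a" where
  "graph_map L0 L1 L = (THE T. T \<in> L0 \<rightarrow>\<^sub>E L1 \<and>
     (\<forall>x\<in>L0. \<forall>y\<in>L0. T (x + y) = T x + T y) \<and>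
     (\<forall>c. \<forall>x\<in>L0. T (c *\<^sub>R x) = c *\<^sub>R T x) \<and>
     L = (\<lambda>x. x + T x) ` L0)"

text \<open>
  The value of the chart at \<open>L\<close>, a symmetric bilinear form on \<open>L0\<close>. It is meaningful for
  \<open>L0 \<in> transverse_lagrangians \<omega> L1\<close>, \<open>L \<in> transverse_lagrangians \<omega> L1\<close> and arguments in \<open>L0\<close>.
\<close>

definition chart ::
    "('a::euclidean_space \<Rightarrow> 'a \<Rightarrow> real) \<Rightarrow> 'a set \<Rightarrow> 'a set \<Rightarrow> 'a set \<Rightarrow> 'a \<Rightarrow> 'a \<Rightarrow> real" where
  "chart \<omega> L0 L1 L = (\<lambda>x y. \<omega> (graph_map L0 L1 L x) y)"

text \<open>Index and coindex of a symmetric bilinear form \<open>B\<close> on a subspace \<open>W\<close>.\<close>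

definition form_index :: "'a::euclidean_space set \<Rightarrow> ('a \<Rightarrow> 'a \<Rightarrow> real) \<Rightarrow> nat" where
  "form_index W B =
     Max {dim S | S. subspace S \<and> S \<subseteq> W \<and> (\<forall>x\<in>S. x \<noteq> 0 \<longrightarrow> B x x < 0)}"

definition form_coindex :: "'a::euclidean_space set \<Rightarrow> ('a \<Rightarrow> 'a \<Rightarrow> real) \<Rightarrow> nat" where
  "form_coindex W B = form_index W (\<lambda>x y. - B x y)"

text \<open>
  The manifold topology of the Lagrangian Grassmannian: the coarsest topology in which all
  chart domains are open (take \<open>U = UNIV\<close>) and all charts are continuous. The charts take
  values in the finite-dimensional space of symmetric bilinear forms on \<open>L0\<close>, whose topology
  is that of pointwise convergence on \<open>L0 \<times> L0\<close>. The underlying set is the set of all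
  Lagrangians, since every Lagrangian has a transverse one.
\<close>

definition lagrangian_topology ::
    "('a::euclidean_space \<Rightarrow> 'a \<Rightarrow> real) \<Rightarrow> 'a set topology" where
  "lagrangian_topology \<omega> = topology_generated_by
     {{L \<in> transverse_lagrangians \<omega> L1. chart \<omega> L0 L1 L x y \<in> U} | L0 L1 x y U.
        lagrangian \<omega> L1 \<and> L0 \<in> transverse_lagrangians \<omega> L1 \<and> x \<in> L0 \<and> y \<in> L0 \<and> open U}"

definition lagrangian_path ::
    "('a::euclidean_space \<Rightarrow> 'a \<Rightarrow> real) \<Rightarrow> real \<Rightarrow> real \<Rightarrow> (real \<Rightarrow> 'a set) \<Rightarrow> bool" where
  "lagrangian_path \<omega> a b l \<longleftrightarrow>
     continuous_map (top_of_set {a..b}) (lagrangian_topology \<omega>) l"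

text \<open>
  \<open>\<mu> a b l\<close> is the \<open>L0\<close>-Maslov index of the restriction of \<open>l\<close> to \<open>{a..b}\<close>. The three clauses
  are homotopy invariance with fixed endpoints, additivity under concatenation, and the value
  on paths in the domain of a chart; they determine \<open>\<mu> a b l\<close> whenever \<open>a \<le> b\<close> and
  \<open>lagrangian_path \<omega> a b l\<close>. By the first clause \<open>\<mu> a b l\<close> depends only on the values of \<open>l\<close>
  on \<open>{a..b}\<close>, so the second covers the concatenation of two paths \<open>{a..b}\<close> and \<open>{b..c}\<close> given
  as different functions.
\<close>

definition is_maslov_index ::
    "('a::euclidean_space \<Rightarrow> 'a \<Rightarrow> real) \<Rightarrow> 'a set \<Rightarrow>
       (real \<Rightarrow> real \<Rightarrow> (real \<Rightarrow> 'a set) \<Rightarrow> int) \<Rightarrow> bool" where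
  "is_maslov_index \<omega> L0 \<mu> \<longleftrightarrow>
     (\<forall>a b l l'. a \<le> b \<longrightarrow>
        homotopic_with (\<lambda>h. h a = l a \<and> h b = l b)
          (top_of_set {a..b}) (lagrangian_topology \<omega>) l l' \<longrightarrow>
        \<mu> a b l = \<mu> a b l') \<and>
     (\<forall>a b c l. a \<le> b \<longrightarrow> b \<le> c \<longrightarrow> lagrangian_path \<omega> a c l \<longrightarrow>
        \<mu> a c l = \<mu> a b l + \<mu> b c l) \<and>
     (\<forall>a b l L1. a \<le> b \<longrightarrow> lagrangian_path \<omega> a b l \<longrightarrow>
        lagrangian \<omega> L1 \<longrightarrow> L0 \<inter> L1 = {0} \<longrightarrow> l ` {a..b} \<subseteq> transverse_lagrangians \<omega> L1 \<longrightarrow>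
        \<mu> a b l = int (form_coindex L0 (chart \<omega> L0 L1 (l b)))
                - int (form_coindex L0 (chart \<omega> L0 L1 (l a))))"

end

theory Submission
  imports Defs
begin

text \<open>
  The difference of the two Maslov indices of a path has a potential: there is an integer
  function \<open>f\<close> of a Lagrangian, depending on \<open>L0\<close> and \<open>L1\<close> only, such that the difference is
  \<open>f(l b) - f(l a)\<close> (\<open>maslov_index_diff\<close>), and \<open>f\<close> takes its values between \<open>0\<close> and
  \<open>n - dim (L0 \<inter> L1)\<close> (\<open>coindex_defect_bounds\<close>).

  Let \<open>K\<close> be a Lagrangian transverse to \<open>L0\<close>, \<open>L1\<close> and \<open>L\<close>; one exists because a vector space is
  not a finite union of proper subspaces (\<open>exists_common_transverse_lagrangian\<close>). Identify all
  complements of \<open>K\<close> by projection along \<open>K\<close>. If \<open>B\<close> and \<open>C\<close> are the charts of \<open>L\<close> and \<open>L1\<close> centred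
  at \<open>L0\<close>, then the chart of \<open>L\<close> centred at \<open>L1\<close> is \<open>B - C\<close>, and the kernel of \<open>C\<close> is \<open>L0 \<inter> L1\<close>. Put
  \<open>f(L) = n\<^sub>+(B) - n\<^sub>+(B - C) + n\<^sub>+(- C)\<close>. As the coindex is subadditive,
  \<open>0 \<le> f(L) \<le> n\<^sub>+(C) + n\<^sub>+(- C)\<close>, and by Sylvester's law the right-hand side is the rank
  \<open>n - dim (L0 \<inter> L1)\<close> of \<open>C\<close>.

  The main point is that \<open>f(L)\<close> does not depend on \<open>K\<close>. By Sylvester's law
  \<open>f(L) = n\<^sub>+(B) + n\<^sub>+(- C) + n\<^sub>+(C - B) + dim (L1 \<inter> L) - n\<close>. The three forms here have sum zero, so
  by a linear substitution the sum of their coindices is the coindex of the Kashiwara form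
  \<open>\<omega> x y + \<omega> y z + \<omega> z x\<close> on \<open>L0 \<times> L1 \<times> L\<close> (\<open>form_coindex_kashiwara\<close>), in which \<open>K\<close> does not
  occur.

  Near each parameter the path stays transverse to one such \<open>K\<close>, and there the difference of the
  two Maslov indices is the increment of \<open>n\<^sub>+(B) - n\<^sub>+(B - C) = f(L) - n\<^sub>+(- C)\<close>, where \<open>C\<close> is
  constant along the path. Additivity under concatenation gives the statement on the whole
  interval.
\<close>

section \<open>Dimension counts and annihilators\<close>

lemma dim_sums_trivial_Int:
  fixes S T :: "'a::euclidean_space set"
  assumes "subspace S" "subspace T" "S \<inter> T \<subseteq> {0}"
  shows "dim {x + y |x y. x \<in> S \<and> y \<in> T} = dim S + dim T"
proof -
  have "dim (S \<inter> T) = 0" using assms(3) by simp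
  then show ?thesis using dim_sums_Int[OF assms(1,2)] by linarith
qed

lemma dim_add_le_dim_Int:
  fixes S T W :: "'a::euclidean_space set"
  assumes "subspace S" "subspace T" "subspace W" "S \<subseteq> W" "T \<subseteq> W"
  shows "dim S + dim T \<le> dim W + dim (S \<inter> T)"
proof -
  have "{x + y |x y. x \<in> S \<and> y \<in> T} \<subseteq> W"
    using assms by (auto intro: subspace_add)
  from dim_subset[OF this] show ?thesis using dim_sums_Int[OF assms(1,2)] by linarith
qed

lemma dim_linear_image_inj:
  fixes f :: "'a::euclidean_space \<Rightarrow> 'b::euclidean_space"
  assumes "linear f" "subspace S" "inj_on f S"
  shows "dim (f ` S) = dim S"
  using dim_image_eq[OF assms(1), of S] assms(2,3) span_eq_iff by metis

text \<open>
  A bilinear form is represented through the inner product; this turns annihilators into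
  orthogonal complements, whose dimensions are known.
\<close>

lemma bilinear_eq_inner:
  fixes B :: "'a::euclidean_space \<Rightarrow> 'a \<Rightarrow> real"
  assumes "bilinear B"
  obtains J where "linear J" "\<And>x y. B x y = J x \<bullet> y"
proof
  have lin: "linear (B x)" for x using assms by (simp add: bilinear_def)
  show eq: "B x y = adjoint (B x) 1 \<bullet> y" for x y
    using adjoint_works[OF lin, of y x 1] by (simp add: inner_commute)
  show "linear (\<lambda>x. adjoint (B x) 1)"
  proof (rule linearI)
    fix x y c
    have "adjoint (B (x + y)) 1 \<bullet> z = (adjoint (B x) 1 + adjoint (B y) 1) \<bullet> z" for z
      by (simp only: inner_add_left eq[symmetric] bilinear_ladd[OF assms])
    then show "adjoint (B (x + y)) 1 = adjoint (B x) 1 + adjoint (B y) 1"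
      using vector_eq_rdot by blast
    have "adjoint (B (c *\<^sub>R x)) 1 \<bullet> z = (c *\<^sub>R adjoint (B x) 1) \<bullet> z" for z
      by (simp only: inner_scaleR_left eq[symmetric] bilinear_lmul[OF assms] real_scaleR_def)
    then show "adjoint (B (c *\<^sub>R x)) 1 = c *\<^sub>R adjoint (B x) 1"
      using vector_eq_rdot by blast
  qed
qed

lemma subspace_annihilator:
  assumes "bilinear B" "subspace W"
  shows "subspace {x \<in> W. \<forall>p\<in>P. B p x = 0}"
  using assms
  by (auto simp: subspace_def bilinear_radd bilinear_rmul bilinear_rzero)

lemma dim_annihilator_ge:
  fixes B :: "'a::euclidean_space \<Rightarrow> 'a \<Rightarrow> real"
  assumes "bilinear B" "subspace W" "subspace P"
  shows "dim W \<le> dim P + dim {x \<in> W. \<forall>p\<in>P. B p x = 0}"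
proof -
  obtain J where J: "linear J" "\<And>x y. B x y = J x \<bullet> y"
    using bilinear_eq_inner[OF assms(1)] by blast
  define A where "A = {y. \<forall>x\<in>J ` P. orthogonal x y}"
  have subJ: "subspace (J ` P)" by (simp add: J assms linear_subspace_image)
  have dA: "dim A + dim (J ` P) = DIM('a)"
    using dim_subspace_orthogonal_to_vectors[OF subJ subspace_UNIV] by (simp add: A_def)
  have "subspace A" by (auto simp: A_def subspace_def orthogonal_clauses)
  moreover have "W \<inter> A = {x \<in> W. \<forall>p\<in>P. B p x = 0}"
    by (auto simp: A_def J orthogonal_def)
  moreover have "dim W + dim A \<le> DIM('a) + dim (W \<inter> A)" if "subspace A"
    using dim_add_le_dim_Int[OF assms(2) that subspace_UNIV] by simp
  moreover have "dim (J ` P) \<le> dim P" using J(1) dim_image_le by blast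
  ultimately show ?thesis using dA by fastforce
qed

text \<open>
  A real vector space is not a finite union of proper subspaces. One subspace is added at a
  time: if \<open>v\<close> avoids the old ones but lies in the new one \<open>U\<close>, and \<open>w\<close> is outside \<open>U\<close>, then
  the line \<open>w + t v\<close> misses \<open>U\<close> and meets each old subspace at most once.
\<close>

lemma avoid_finitely_many_subspaces:
  fixes W :: "'a::real_vector set"
  assumes "finite F" "subspace W" "\<And>A. A \<in> F \<Longrightarrow> subspace A \<and> \<not> W \<subseteq> A"
  obtains v where "v \<in> W" "v \<notin> \<Union>F"
proof -
  have "\<exists>v\<in>W. v \<notin> \<Union>F"
    using assms(1,3)
  proof (induction F rule: finite_induct)
    case empty
    then show ?case using subspace_0[OF assms(2)] by auto
  next
    case (insert U F)
    then obtain v where v: "v \<in> W" "v \<notin> \<Union>F" by blast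
    obtain w where w: "w \<in> W" "w \<notin> U" using insert.prems by blast
    show ?case
    proof (cases "v \<in> U")
      case False
      then show ?thesis using v by auto
    next
      case True
      have U: "subspace U" using insert.prems by blast
      have notU: "w + t *\<^sub>R v \<notin> U" for t
        using w(2) True U by (metis add_diff_cancel_right' subspace_diff subspace_mul)
      define bad where "bad A = {t::real. w + t *\<^sub>R v \<in> A}" for A
      have "finite (bad A)" if A: "A \<in> F" for A
      proof (cases "bad A = {}")
        case False
        then obtain s where s: "s \<in> bad A" by blast
        have sA: "subspace A" using insert.prems A by blast
        have "t = s" if "t \<in> bad A" for t
        proof (rule ccontr)
          assume "t \<noteq> s"
          have "(w + t *\<^sub>R v) - (w + s *\<^sub>R v) \<in> A"
            using that s sA subspace_diff unfolding bad_def by blast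
          then have "(t - s) *\<^sub>R v \<in> A" by (simp add: algebra_simps)
          then have "(1 / (t - s)) *\<^sub>R (t - s) *\<^sub>R v \<in> A" using sA subspace_mul by blast
          then have "v \<in> A" using \<open>t \<noteq> s\<close> by simp
          then show False using v A by blast
        qed
        then have "bad A \<subseteq> {s}" by blast
        then show ?thesis using finite_subset by blast
      qed auto
      then have "finite (\<Union>A\<in>F. bad A)" using insert.hyps(1) by blast
      then obtain t where "t \<notin> (\<Union>A\<in>F. bad A)"
        using ex_new_if_finite infinite_UNIV_char_0 by blast
      then have "w + t *\<^sub>R v \<notin> \<Union>(insert U F)" using notU by (auto simp: bad_def)
      then show ?thesis using v w assms(2) by (metis subspace_add subspace_mul)
    qed
  qed
  then show thesis using that by blast
qed

section \<open>The coindex and Sylvester's law of inertia\<close>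

text \<open>
  Symmetric bilinear forms are taken on the whole type; the subspace on which the coindex is
  counted is a separate argument. The coindex itself depends only on the values \<open>B x x\<close>.
\<close>

definition sym_bilinear :: "('a::euclidean_space \<Rightarrow> 'a \<Rightarrow> real) \<Rightarrow> bool" where
  "sym_bilinear B \<longleftrightarrow> bilinear B \<and> (\<forall>x y. B x y = B y x)"

lemma sym_bilinearD:
  assumes "sym_bilinear B"
  shows "bilinear B" "B x y = B y x"
  using assms by (auto simp: sym_bilinear_def)

lemma bilinear_uminus_form: "bilinear B \<Longrightarrow> bilinear (\<lambda>x y. - B x y)"
  unfolding bilinear_def by (auto intro: linear_compose_neg)

lemma sym_bilinear_uminus: "sym_bilinear B \<Longrightarrow> sym_bilinear (\<lambda>x y. - B x y)"
  by (auto simp: sym_bilinear_def bilinear_uminus_form)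

lemma form_coindex_eq_Max:
  "form_coindex W B = Max {dim S | S. subspace S \<and> S \<subseteq> W \<and> (\<forall>x\<in>S. x \<noteq> 0 \<longrightarrow> 0 < B x x)}"
  by (simp add: form_coindex_def form_index_def)

lemma finite_positive_dims:
  fixes W :: "'a::euclidean_space set"
  shows "finite {dim S | S. subspace S \<and> S \<subseteq> W \<and> (\<forall>x\<in>S. x \<noteq> 0 \<longrightarrow> 0 < B x x)}"
  by (rule finite_subset[of _ "{..DIM('a)}"]) (auto simp: dim_subset_UNIV)

lemma form_coindex_ge:
  assumes "subspace S" "S \<subseteq> W" "\<And>x. x \<in> S \<Longrightarrow> x \<noteq> 0 \<Longrightarrow> 0 < B x x"
  shows "dim S \<le> form_coindex W B"
  unfolding form_coindex_eq_Max using assms by (intro Max_ge finite_positive_dims) blast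

lemma form_coindex_attained:
  assumes "subspace W"
  obtains S where "subspace S" "S \<subseteq> W" "\<And>x. x \<in> S \<Longrightarrow> x \<noteq> 0 \<Longrightarrow> 0 < B x x"
    "dim S = form_coindex W B"
proof -
  let ?D = "{dim S | S. subspace S \<and> S \<subseteq> W \<and> (\<forall>x\<in>S. x \<noteq> 0 \<longrightarrow> 0 < B x x)}"
  have "dim {0::'a} \<in> ?D"
    using subspace_0[OF assms] by (intro CollectI exI[of _ "{0}"]) auto
  then have "form_coindex W B \<in> ?D"
    unfolding form_coindex_eq_Max by (intro Max_in finite_positive_dims) blast
  then show thesis using that by force
qed

text \<open>
  A subspace on which \<open>B\<close> is nonpositive meets every positive definite one trivially.
\<close>

lemma form_coindex_le:
  assumes "subspace W" "subspace N" "N \<subseteq> W" "\<And>x. x \<in> N \<Longrightarrow> B x x \<le> 0"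
  shows "form_coindex W B + dim N \<le> dim W"
proof -
  obtain S where S: "subspace S" "S \<subseteq> W" "\<And>x. x \<in> S \<Longrightarrow> x \<noteq> 0 \<Longrightarrow> 0 < B x x"
    "dim S = form_coindex W B"
    using form_coindex_attained[OF assms(1)] by blast
  have "S \<inter> N \<subseteq> {0}" using S(3) assms(4) by force
  then have "dim (S \<inter> N) = 0" by simp
  then show ?thesis
    using dim_add_le_dim_Int[OF S(1) assms(2,1) S(2) assms(3)] S(4) by linarith
qed

lemma form_coindex_linear_image:
  fixes f :: "'a::euclidean_space \<Rightarrow> 'b::euclidean_space"
  assumes "linear f" "inj_on f W" "subspace W"
    and eq: "\<And>x. x \<in> W \<Longrightarrow> B' (f x) (f x) = B x x"
  shows "form_coindex (f ` W) B' = form_coindex W B"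
proof (rule antisym)
  have sW: "subspace (f ` W)" using assms by (simp add: linear_subspace_image)
  obtain S where S: "subspace S" "S \<subseteq> f ` W" "\<And>x. x \<in> S \<Longrightarrow> x \<noteq> 0 \<Longrightarrow> 0 < B' x x"
    "dim S = form_coindex (f ` W) B'"
    using form_coindex_attained[OF sW] by blast
  let ?R = "W \<inter> f -` S"
  have R: "subspace ?R"
    using assms S(1) by (intro subspace_inter linear_subspace_vimage)
  have "f ` ?R = S" using S(2) by auto
  then have "dim S = dim ?R"
    using dim_linear_image_inj[OF assms(1) R] assms(2) by (metis Int_lower1 inj_on_subset)
  also have "\<dots> \<le> form_coindex W B"
  proof (rule form_coindex_ge[OF R])
    fix x assume x: "x \<in> ?R" "x \<noteq> 0"
    have "f x \<noteq> f 0"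
      using x assms(2) subspace_0[OF assms(3)] unfolding inj_on_def by blast
    then show "0 < B x x" using S(3)[of "f x"] x eq[of x] linear_0[OF assms(1)] by simp
  qed simp
  finally show "form_coindex (f ` W) B' \<le> form_coindex W B" using S(4) by simp
next
  obtain S where S: "subspace S" "S \<subseteq> W" "\<And>x. x \<in> S \<Longrightarrow> x \<noteq> 0 \<Longrightarrow> 0 < B x x"
    "dim S = form_coindex W B"
    using form_coindex_attained[OF assms(3)] by blast
  have "dim S = dim (f ` S)"
    using dim_linear_image_inj[OF assms(1) S(1)] assms(2) S(2) by (metis inj_on_subset)
  also have "\<dots> \<le> form_coindex (f ` W) B'"
  proof (rule form_coindex_ge)
    show "subspace (f ` S)" using assms S by (simp add: linear_subspace_image)
    show "f ` S \<subseteq> f ` W" using S by blast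
    fix y assume y: "y \<in> f ` S" "y \<noteq> 0"
    then obtain x where x: "x \<in> S" "y = f x" by blast
    then have "x \<noteq> 0" using y linear_0[OF assms(1)] by auto
    then show "0 < B' y y" using S x eq by (metis subsetD)
  qed
  finally show "form_coindex W B \<le> form_coindex (f ` W) B'" using S(4) by simp
qed

text \<open>
  A maximal positive definite subspace \<open>P\<close> and its \<open>B\<close>-orthogonal complement \<open>N\<close>: a vector of
  \<open>N\<close> with positive square would enlarge \<open>P\<close>.
\<close>

lemma inertia_decomposition:
  fixes W :: "'a::euclidean_space set"
  assumes B: "sym_bilinear B" and W: "subspace W"
  obtains P N where "subspace P" "subspace N" "P \<subseteq> W" "N \<subseteq> W"
    "\<forall>x\<in>P. x \<noteq> 0 \<longrightarrow> 0 < B x x" "\<forall>x\<in>N. B x x \<le> 0"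
    "\<forall>x\<in>P. \<forall>y\<in>N. B x y = 0"
    "dim P = form_coindex W B" "dim P + dim N = dim W"
proof -
  note bil = sym_bilinearD(1)[OF B] and sym = sym_bilinearD(2)[OF B]
  obtain P where P: "subspace P" "P \<subseteq> W" "\<And>x. x \<in> P \<Longrightarrow> x \<noteq> 0 \<Longrightarrow> 0 < B x x"
    "dim P = form_coindex W B"
    using form_coindex_attained[OF W] by blast
  define N where "N = {x \<in> W. \<forall>p\<in>P. B p x = 0}"
  have N: "subspace N" "N \<subseteq> W" "\<And>x y. x \<in> P \<Longrightarrow> y \<in> N \<Longrightarrow> B x y = 0"
    using subspace_annihilator[OF bil W] by (auto simp: N_def)
  have "P \<inter> N \<subseteq> {0}" using P(3) N(3) by force
  then have "dim (P \<inter> N) = 0" by simp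
  then have "dim P + dim N \<le> dim W"
    using dim_add_le_dim_Int[OF P(1) N(1) W P(2) N(2)] by linarith
  moreover have "dim W \<le> dim P + dim N"
    using dim_annihilator_ge[OF bil W P(1)] by (simp add: N_def)
  ultimately have dims: "dim P + dim N = dim W" by simp
  have neg: "B x x \<le> 0" if x: "x \<in> N" for x
  proof (rule ccontr)
    assume pos: "\<not> B x x \<le> 0"
    have "x \<notin> P" using pos N(3)[of x x] x by auto
    then have "dim (span (insert x P)) = dim P + 1"
      using P(1) by (simp add: dim_insert span_eq_iff[THEN iffD2])
    moreover have "dim (span (insert x P)) \<le> form_coindex W B"
    proof (rule form_coindex_ge)
      show "span (insert x P) \<subseteq> W" using x N(2) P(2) W by (intro span_minimal) auto
      fix y assume y: "y \<in> span (insert x P)" "y \<noteq> 0"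
      then obtain c where "y - c *\<^sub>R x \<in> P"
        using P(1) by (auto simp: span_breakdown_eq span_eq_iff[THEN iffD2])
      then obtain p where pc: "p \<in> P" "y = p + c *\<^sub>R x" by (metis diff_add_cancel)
      have eq: "B y y = B p p + c\<^sup>2 * B x x"
        using N(3)[OF pc(1) x] sym[of x p]
        by (simp add: pc(2) bilinear_ladd[OF bil] bilinear_radd[OF bil]
            bilinear_lmul[OF bil] bilinear_rmul[OF bil] power2_eq_square)
      show "0 < B y y"
      proof (cases "p = 0")
        case True
        then have "c \<noteq> 0" using y pc by auto
        then show ?thesis using eq True pos bilinear_lzero[OF bil] by simp
      next
        case False
        then have "0 < B p p" using P(3) pc by blast
        moreover have "0 \<le> c\<^sup>2 * B x x" using pos by simp
        ultimately show ?thesis using eq by linarith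
      qed
    qed simp
    ultimately show False using P(4) by simp
  qed
  show thesis using that[OF P(1) N(1) P(2) N(2)] P(3) neg N(3) P(4) dims by blast
qed

lemma form_coindex_add_le:
  assumes "sym_bilinear A" "sym_bilinear B" "subspace W"
  shows "form_coindex W (\<lambda>x y. A x y + B x y) \<le> form_coindex W A + form_coindex W B"
proof -
  obtain P M where P1: "subspace P" and M1: "subspace M" and P2: "P \<subseteq> W"
    and M2: "M \<subseteq> W" and P3: "\<forall>x\<in>P. x \<noteq> 0 \<longrightarrow> 0 < A x x"
    and M3: "\<forall>x\<in>M. A x x \<le> 0"
    and PM: "\<forall>x\<in>P. \<forall>y\<in>M. A x y = 0"
    and P4: "dim P = form_coindex W A" and M4: "dim P + dim M = dim W"
    using inertia_decomposition[OF assms(1,3)] by metis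
  obtain Q N where Q1: "subspace Q" and N1: "subspace N" and Q2: "Q \<subseteq> W"
    and N2: "N \<subseteq> W" and Q3: "\<forall>x\<in>Q. x \<noteq> 0 \<longrightarrow> 0 < B x x"
    and N3: "\<forall>x\<in>N. B x x \<le> 0"
    and QN: "\<forall>x\<in>Q. \<forall>y\<in>N. B x y = 0"
    and Q4: "dim Q = form_coindex W B" and N4: "dim Q + dim N = dim W"
    using inertia_decomposition[OF assms(2,3)] by metis
  have "form_coindex W (\<lambda>x y. A x y + B x y) + dim (M \<inter> N) \<le> dim W"
  proof (rule form_coindex_le[OF assms(3)])
    show "subspace (M \<inter> N)" using M1 N1 by (rule subspace_inter)
    show "A x x + B x x \<le> 0" if "x \<in> M \<inter> N" for x
      using M3 N3 that by (meson IntD1 IntD2 add_nonpos_nonpos)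
  qed (use M2 in blast)
  then show ?thesis
    using dim_add_le_dim_Int[OF M1 N1 assms(3) M2 N2] P4 M4 Q4 N4 by linarith
qed

text \<open>
  The inequality in Sylvester's law, for any subspace \<open>K\<close> of the kernel: the sum of \<open>K\<close> and a
  maximal negative definite subspace is nonpositive.
\<close>

lemma form_coindex_uminus_add_le:
  assumes B: "sym_bilinear B" and W: "subspace W"
    and K: "subspace K" "K \<subseteq> W" "\<And>x y. x \<in> K \<Longrightarrow> y \<in> W \<Longrightarrow> B x y = 0"
  shows "form_coindex W B + form_coindex W (\<lambda>x y. - B x y) + dim K \<le> dim W"
proof -
  note bil = sym_bilinearD(1)[OF B] and sym = sym_bilinearD(2)[OF B]
  obtain S where S: "subspace S" "S \<subseteq> W" "\<And>x. x \<in> S \<Longrightarrow> x \<noteq> 0 \<Longrightarrow> 0 < - B x x"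
    "dim S = form_coindex W (\<lambda>x y. - B x y)"
    using form_coindex_attained[OF W, of "\<lambda>x y. - B x y"] by blast
  have "S \<inter> K \<subseteq> {0}" using S(2,3) K(3) by force
  then have d: "dim {x + y |x y. x \<in> S \<and> y \<in> K} = dim S + dim K"
    using dim_sums_trivial_Int S(1) K(1) by blast
  have "form_coindex W B + dim {x + y |x y. x \<in> S \<and> y \<in> K} \<le> dim W"
  proof (rule form_coindex_le[OF W subspace_sums[OF S(1) K(1)]])
    show "{x + y |x y. x \<in> S \<and> y \<in> K} \<subseteq> W" using S(2) K(2) W subspace_add by blast
    fix z assume "z \<in> {x + y |x y. x \<in> S \<and> y \<in> K}"
    then obtain x y where xy: "x \<in> S" "y \<in> K" "z = x + y" by blast
    have "B y x = 0" "B y y = 0" using K xy S(2) by blast+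
    then have "B z z = B x x"
      using sym[of x y] by (simp add: xy bilinear_ladd[OF bil] bilinear_radd[OF bil])
    also have "\<dots> \<le> 0"
      using S(3)[OF xy(1)] bilinear_lzero[OF bil] by (cases "x = 0") force+
    finally show "B z z \<le> 0" .
  qed
  then show ?thesis using d S(4) by simp
qed

text \<open>
  Sylvester's law: coindex, index and nullity add up to the dimension.
\<close>

lemma form_coindex_uminus_add_eq:
  fixes W :: "'a::euclidean_space set"
  assumes B: "sym_bilinear B" and W: "subspace W"
  shows "form_coindex W B + form_coindex W (\<lambda>x y. - B x y)
     + dim {x \<in> W. \<forall>y\<in>W. B x y = 0} = dim W"
proof -
  note bil = sym_bilinearD(1)[OF B] and sym = sym_bilinearD(2)[OF B]
  define K where "K = {x \<in> W. \<forall>y\<in>W. B x y = 0}"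
  have K: "subspace K"
    using subspace_annihilator[OF bil W, of W] sym by (simp add: K_def sym)
  obtain P N where P1: "subspace P" and N1: "subspace N" and P2: "P \<subseteq> W"
    and N2: "N \<subseteq> W" and P3: "\<forall>x\<in>P. x \<noteq> 0 \<longrightarrow> 0 < B x x"
    and N3: "\<forall>x\<in>N. B x x \<le> 0"
    and PN: "\<forall>x\<in>P. \<forall>y\<in>N. B x y = 0"
    and P4: "dim P = form_coindex W B" and N4: "dim P + dim N = dim W"
    using inertia_decomposition[OF B W] by metis
  obtain Q Z where Q1: "subspace Q" and Z1: "subspace Z" and Q2: "Q \<subseteq> N"
    and Z2: "Z \<subseteq> N" and Q3: "\<forall>x\<in>Q. x \<noteq> 0 \<longrightarrow> 0 < - B x x"
    and Z3: "\<forall>x\<in>Z. - B x x \<le> 0"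
    and QZ: "\<forall>x\<in>Q. \<forall>y\<in>Z. - B x y = 0"
    and Q4: "dim Q = form_coindex N (\<lambda>x y. - B x y)" and Z4: "dim Q + dim Z = dim N"
    using inertia_decomposition[OF sym_bilinear_uminus[OF B] N1] by blast
  have zero: "B x x = 0" if "x \<in> Z" for x using N3 Z2 Z3 that by force
  \<comment> \<open>polarization\<close>
  have ZZ: "B x y = 0" if "x \<in> Z" "y \<in> Z" for x y
  proof -
    have "B (x + y) (x + y) = 0" using zero that Z1 subspace_add by blast
    then show ?thesis using zero that sym[of x y]
      by (simp add: bilinear_ladd[OF bil] bilinear_radd[OF bil])
  qed
  have "Q \<inter> Z \<subseteq> {0}" using Q3 zero by force
  then have "dim {x + y |x y. x \<in> Q \<and> y \<in> Z} = dim N"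
    using dim_sums_trivial_Int[OF Q1 Z1] Z4 by simp
  moreover have "{x + y |x y. x \<in> Q \<and> y \<in> Z} \<subseteq> N" using Q2 Z2 N1 subspace_add by blast
  ultimately have Neq: "{x + y |x y. x \<in> Q \<and> y \<in> Z} = N"
    using subspace_dim_equal[OF subspace_sums[OF Q1 Z1] N1] by simp
  have "P \<inter> N \<subseteq> {0}" using P3 N3 by force
  then have "dim {x + y |x y. x \<in> P \<and> y \<in> N} = dim W"
    using dim_sums_trivial_Int[OF P1 N1] N4 by simp
  moreover have "{x + y |x y. x \<in> P \<and> y \<in> N} \<subseteq> W" using P2 N2 W subspace_add by blast
  ultimately have Weq: "{x + y |x y. x \<in> P \<and> y \<in> N} = W"
    using subspace_dim_equal[OF subspace_sums[OF P1 N1] W] by simp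
  have "B z y = 0" if z: "z \<in> Z" and y: "y \<in> W" for z y
  proof -
    obtain p q r where pqr: "p \<in> P" "q \<in> Q" "r \<in> Z" "y = p + (q + r)"
      using y Weq Neq by blast
    then have "B p z = 0" "B q z = 0" "B r z = 0" using PN QZ ZZ z Z2 by force+
    then show ?thesis
      using sym[of z] by (simp add: pqr(4) bilinear_radd[OF bil])
  qed
  then have "Z \<subseteq> K" using Z2 N2 by (auto simp: K_def)
  then have "dim Z \<le> dim K" by (rule dim_subset)
  moreover have "dim Q \<le> form_coindex W (\<lambda>x y. - B x y)"
    using Q1 Q2 Q3 N2 by (intro form_coindex_ge) auto
  moreover have "form_coindex W B + form_coindex W (\<lambda>x y. - B x y) + dim K \<le> dim W"
    by (rule form_coindex_uminus_add_le[OF B W K]) (auto simp: K_def)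
  ultimately show ?thesis using P4 N4 Z4 unfolding K_def by linarith
qed

lemma sym_bilinear_direct_sum:
  assumes "sym_bilinear A" "sym_bilinear B"
  shows "sym_bilinear (\<lambda>p q. A (fst p) (fst q) + B (snd p) (snd q))"
  using assms
  by (auto simp: sym_bilinear_def bilinear_def linear_iff scaleR_right_distrib algebra_simps)

lemma form_coindex_direct_sum:
  fixes X :: "'a::euclidean_space set" and Y :: "'b::euclidean_space set"
  assumes A: "sym_bilinear A" and B: "sym_bilinear B" and X: "subspace X" and Y: "subspace Y"
  shows "form_coindex (X \<times> Y) (\<lambda>p q. A (fst p) (fst q) + B (snd p) (snd q))
    = form_coindex X A + form_coindex Y B"
proof -
  note bA = sym_bilinearD(1)[OF A] and bB = sym_bilinearD(1)[OF B]
  obtain P M where P1: "subspace P" and M1: "subspace M" and P2: "P \<subseteq> X"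
    and M2: "M \<subseteq> X" and P3: "\<forall>x\<in>P. x \<noteq> 0 \<longrightarrow> 0 < A x x"
    and M3: "\<forall>x\<in>M. A x x \<le> 0"
    and PM: "\<forall>x\<in>P. \<forall>y\<in>M. A x y = 0"
    and P4: "dim P = form_coindex X A" and M4: "dim P + dim M = dim X"
    using inertia_decomposition[OF A X] by metis
  obtain Q N where Q1: "subspace Q" and N1: "subspace N" and Q2: "Q \<subseteq> Y"
    and N2: "N \<subseteq> Y" and Q3: "\<forall>x\<in>Q. x \<noteq> 0 \<longrightarrow> 0 < B x x"
    and N3: "\<forall>x\<in>N. B x x \<le> 0"
    and QN: "\<forall>x\<in>Q. \<forall>y\<in>N. B x y = 0"
    and Q4: "dim Q = form_coindex Y B" and N4: "dim Q + dim N = dim Y"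
    using inertia_decomposition[OF B Y] by metis
  let ?C = "\<lambda>p q. A (fst p) (fst q) + B (snd p) (snd q)"
  have "dim (P \<times> Q) \<le> form_coindex (X \<times> Y) ?C"
  proof (rule form_coindex_ge)
    show "subspace (P \<times> Q)" using P1 Q1 by (simp add: subspace_Times)
    fix z assume z: "z \<in> P \<times> Q" "z \<noteq> 0"
    obtain x y where xy: "z = (x, y)" "x \<in> P" "y \<in> Q" using z(1) by blast
    then have "x \<noteq> 0 \<or> y \<noteq> 0" using z(2) by (auto simp: zero_prod_def)
    then show "0 < ?C z z"
      using P3 Q3 xy(2,3) bilinear_lzero[OF bA] bilinear_lzero[OF bB]
      by (cases "x = 0"; cases "y = 0") (auto simp: xy(1) intro: add_pos_pos)
  qed (use P2 Q2 in auto)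
  moreover have "form_coindex (X \<times> Y) ?C + dim (M \<times> N) \<le> dim (X \<times> Y)"
  proof (rule form_coindex_le)
    show "?C z z \<le> 0" if "z \<in> M \<times> N" for z
      using M3 N3 that by (auto intro: add_nonpos_nonpos)
  qed (use M1 M2 N1 N2 X Y in \<open>auto simp: subspace_Times\<close>)
  ultimately show ?thesis
    using P1 P4 Q1 Q4 M1 M4 N1 N4 X Y by (simp add: dim_Times)
qed

section \<open>Lagrangian subspaces and common complements\<close>

lemma
  assumes "symplectic_form \<omega>"
  shows symplectic_form_bilinear: "bilinear \<omega>"
    and symplectic_form_self: "\<omega> x x = 0"
    and symplectic_form_skew: "\<omega> x y = - \<omega> y x"
proof -
  show bil: "bilinear \<omega>" and self: "\<omega> x x = 0" for x
    using assms by (auto simp: symplectic_form_def)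
  have "\<omega> (x + y) (x + y) = \<omega> x x + \<omega> x y + \<omega> y x + \<omega> y y"
    by (simp add: bilinear_ladd[OF bil] bilinear_radd[OF bil])
  then show "\<omega> x y = - \<omega> y x" using self[of "x + y"] self[of x] self[of y] by linarith
qed

lemma dim_symplectic_complement:
  fixes \<omega> :: "'a::euclidean_space \<Rightarrow> 'a \<Rightarrow> real"
  assumes "symplectic_form \<omega>" "subspace K"
  shows "dim {x. \<forall>p\<in>K. \<omega> p x = 0} + dim K = DIM('a)"
proof -
  obtain J where J: "linear J" "\<And>x y. \<omega> x y = J x \<bullet> y"
    using bilinear_eq_inner[OF symplectic_form_bilinear[OF assms(1)]] by blast
  have "x = 0" if "J x = 0" for x
    using assms(1) that by (auto simp: symplectic_form_def J(2))
  then have "inj J" using J(1) by (simp add: linear_injective_0)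
  then have "dim (J ` K) = dim K"
    using dim_linear_image_inj[OF J(1) assms(2)] inj_on_subset by blast
  moreover have "dim {y \<in> UNIV. \<forall>x\<in>J ` K. orthogonal x y} + dim (J ` K) = DIM('a)"
    using dim_subspace_orthogonal_to_vectors[of "J ` K" UNIV] J(1) assms(2)
    by (simp add: linear_subspace_image)
  ultimately show ?thesis by (simp add: J(2) orthogonal_def)
qed

lemma lagrangianD:
  fixes L :: "'a::euclidean_space set"
  assumes "lagrangian \<omega> L"
  shows "subspace L" "2 * dim L = DIM('a)" "x \<in> L \<Longrightarrow> y \<in> L \<Longrightarrow> \<omega> x y = 0"
  using assms by (auto simp: lagrangian_def)

lemma even_dim_lagrangian:
  fixes L :: "'a::euclidean_space set"
  shows "lagrangian \<omega> L \<Longrightarrow> even DIM('a)"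
  by (metis lagrangianD(2) dvd_triv_left)

lemma lagrangian_maximal_isotropic:
  assumes "symplectic_form \<omega>" "lagrangian \<omega> L" "\<And>y. y \<in> L \<Longrightarrow> \<omega> y x = 0"
  shows "x \<in> L"
proof -
  let ?A = "{x. \<forall>p\<in>L. \<omega> p x = 0}"
  have "subspace ?A"
    using subspace_annihilator[OF symplectic_form_bilinear[OF assms(1)] subspace_UNIV, of L] by simp
  moreover have "L \<subseteq> ?A" using lagrangianD(3)[OF assms(2)] by blast
  moreover have "dim ?A \<le> dim L"
    using dim_symplectic_complement[OF assms(1) lagrangianD(1)[OF assms(2)]]
      lagrangianD(2)[OF assms(2)] by linarith
  ultimately have "L = ?A" using subspace_dim_equal lagrangianD(1)[OF assms(2)] by blast
  then show ?thesis using assms(3) by blast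
qed

text \<open>
  If the isotropic subspace \<open>K\<close> is not yet Lagrangian, a vector \<open>v\<close> can be added to it: \<open>v\<close>
  must lie in the symplectic complement \<open>W\<close> of \<open>K\<close>, but neither in \<open>K\<close> nor in any \<open>K + L\<close>.
  These are finitely many subspaces, none of which contains \<open>W\<close>.
\<close>

lemma isotropic_subspace_extend:
  fixes \<omega> :: "'a::euclidean_space \<Rightarrow> 'a \<Rightarrow> real"
  assumes \<omega>: "symplectic_form \<omega>" and F: "finite F" "\<And>L. L \<in> F \<Longrightarrow> lagrangian \<omega> L"
    and K: "subspace K" "\<And>x y. x \<in> K \<Longrightarrow> y \<in> K \<Longrightarrow> \<omega> x y = 0"
    "\<And>L. L \<in> F \<Longrightarrow> K \<inter> L \<subseteq> {0}" "2 * dim K < DIM('a)"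
  obtains K' where "subspace K'" "\<And>x y. x \<in> K' \<Longrightarrow> y \<in> K' \<Longrightarrow> \<omega> x y = 0"
    "\<And>L. L \<in> F \<Longrightarrow> K' \<inter> L \<subseteq> {0}" "dim K' = Suc (dim K)"
proof -
  note bil = symplectic_form_bilinear[OF \<omega>]
  define W where "W = {x. \<forall>p\<in>K. \<omega> p x = 0}"
  have W: "subspace W" "dim W + dim K = DIM('a)" "K \<subseteq> W"
    using subspace_annihilator[OF bil subspace_UNIV, of K] dim_symplectic_complement[OF \<omega> K(1)] K(2)
    by (auto simp: W_def)
  define S where "S L = {x + y |x y. x \<in> K \<and> y \<in> L}" for L
  have S: "subspace (S L)" if "L \<in> F" for L
    unfolding S_def using K(1) lagrangianD(1)[OF F(2)[OF that]] by (rule subspace_sums)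
  \<comment> \<open>Otherwise \<open>W = K + W \<inter> L\<close>, where \<open>W \<inter> L\<close> annihilates \<open>K + L\<close> and so has dimension at most
    \<open>n - k\<close> (with \<open>dim K = k\<close>); but \<open>W\<close> has dimension \<open>2 n - k > n\<close>.\<close>
  have notS: "\<not> W \<subseteq> S L" if L: "L \<in> F" for L
  proof
    assume sub: "W \<subseteq> S L"
    note lag = lagrangianD[OF F(2)[OF L]]
    have sWL: "subspace (W \<inter> L)" using W(1) lag(1) by (rule subspace_inter)
    have "W \<subseteq> {x + y |x y. x \<in> K \<and> y \<in> W \<inter> L}"
    proof
      fix w assume w: "w \<in> W"
      then obtain x y where xy: "x \<in> K" "y \<in> L" "w = x + y" using sub by (auto simp: S_def)
      then have "y \<in> W" using w W(1,3) by (metis add_diff_cancel_left' subsetD subspace_diff)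
      then show "w \<in> {x + y |x y. x \<in> K \<and> y \<in> W \<inter> L}" using xy by blast
    qed
    then have "dim W \<le> dim {x + y |x y. x \<in> K \<and> y \<in> W \<inter> L}" by (rule dim_subset)
    then have 1: "dim W \<le> dim K + dim (W \<inter> L)"
      using dim_sums_Int[OF K(1) sWL] by linarith
    have "W \<inter> L \<subseteq> {x. \<forall>p\<in>S L. \<omega> p x = 0}"
      using lag(3) by (auto simp: S_def W_def bilinear_ladd[OF bil])
    then have "dim (W \<inter> L) \<le> dim {x. \<forall>p\<in>S L. \<omega> p x = 0}" by (rule dim_subset)
    moreover have "dim {x. \<forall>p\<in>S L. \<omega> p x = 0} + dim (S L) = DIM('a)"
      using dim_symplectic_complement[OF \<omega> S[OF L]] .
    moreover have "dim (S L) = dim K + dim L"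
      unfolding S_def using dim_sums_trivial_Int K(1,3) lag(1) L by blast
    ultimately show False using 1 lag(2) W(2) K(4) by linarith
  qed
  have "\<not> W \<subseteq> K"
  proof
    assume "W \<subseteq> K"
    then have "dim W \<le> dim K" by (rule dim_subset)
    then show False using W(2) K(4) by linarith
  qed
  then have proper: "subspace A \<and> \<not> W \<subseteq> A" if "A \<in> insert K (S ` F)" for A
    using that K(1) S notS by blast
  obtain v where v: "v \<in> W" "v \<notin> \<Union>(insert K (S ` F))"
    using avoid_finitely_many_subspaces[OF _ W(1) proper] F(1)
    by (metis finite_imageI finite_insert)
  have vv: "\<omega> v v = 0" by (rule symplectic_form_self[OF \<omega>])
  have vK: "\<omega> x v = 0" "\<omega> v x = 0" if "x \<in> K" for x
    using v(1) that symplectic_form_skew[OF \<omega>, of v x] by (auto simp: W_def)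
  have elem: "\<exists>p\<in>K. \<exists>c. x = p + c *\<^sub>R v" if x: "x \<in> span (insert v K)" for x
  proof -
    obtain c where "x - c *\<^sub>R v \<in> K"
      using x K(1) by (auto simp: span_breakdown_eq span_eq_iff[THEN iffD2])
    then show ?thesis by (metis diff_add_cancel)
  qed
  show thesis
  proof (rule that)
    show "subspace (span (insert v K))" by simp
    show "dim (span (insert v K)) = Suc (dim K)"
      using v(2) K(1) by (simp add: dim_insert span_eq_iff[THEN iffD2])
    show "\<omega> x y = 0" if "x \<in> span (insert v K)" "y \<in> span (insert v K)" for x y
      using elem[OF that(1)] elem[OF that(2)] K(2) vv vK
      by (auto simp: bilinear_ladd[OF bil] bilinear_radd[OF bil] bilinear_lmul[OF bil] bilinear_rmul[OF bil])
    show "span (insert v K) \<inter> L \<subseteq> {0}" if L: "L \<in> F" for L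
    proof
      fix x assume x: "x \<in> span (insert v K) \<inter> L"
      obtain p c where pc: "p \<in> K" "x = p + c *\<^sub>R v" using elem x by blast
      have "c = 0"
      proof (rule ccontr)
        assume "c \<noteq> 0"
        then have "v = (- 1 / c) *\<^sub>R p + (1 / c) *\<^sub>R x" by (simp add: pc algebra_simps)
        moreover have "(- 1 / c) *\<^sub>R p \<in> K" using pc(1) K(1) subspace_mul by blast
        moreover have "(1 / c) *\<^sub>R x \<in> L"
          using x lagrangianD(1)[OF F(2)[OF L]] subspace_mul by blast
        ultimately have "v \<in> S L" unfolding S_def by blast
        then show False using v(2) L by blast
      qed
      then show "x \<in> {0}" using pc x K(3)[OF L] by auto
    qed
  qed
qed

lemma exists_common_transverse_lagrangian:
  fixes \<omega> :: "'a::euclidean_space \<Rightarrow> 'a \<Rightarrow> real"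
  assumes "symplectic_form \<omega>" "even DIM('a)" "finite F" "\<And>L. L \<in> F \<Longrightarrow> lagrangian \<omega> L"
  shows "\<exists>K. lagrangian \<omega> K \<and> (\<forall>L\<in>F. L \<inter> K = {0})"
proof -
  have "\<exists>K. subspace K \<and> (\<forall>x\<in>K. \<forall>y\<in>K. \<omega> x y = 0) \<and> (\<forall>L\<in>F. K \<inter> L \<subseteq> {0}) \<and> dim K = k"
    if "2 * k \<le> DIM('a)" for k
    using that
  proof (induction k)
    case 0
    show ?case
      by (rule exI[of _ "{0}"]) (auto simp: symplectic_form_self[OF assms(1)])
  next
    case (Suc k)
    then obtain K where "subspace K" "\<forall>x\<in>K. \<forall>y\<in>K. \<omega> x y = 0" "\<forall>L\<in>F. K \<inter> L \<subseteq> {0}" "dim K = k"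
      by auto
    with Suc.prems show ?case
      using isotropic_subspace_extend[OF assms(1,3,4), of K] by (smt (verit) Suc_leD mult_Suc_right
          add_2_eq_Suc Suc_le_lessD)
  qed
  from this[of "DIM('a) div 2"] obtain K where K: "subspace K" "\<forall>x\<in>K. \<forall>y\<in>K. \<omega> x y = 0"
    "\<forall>L\<in>F. K \<inter> L \<subseteq> {0}" "2 * dim K = DIM('a)"
    using assms(2) by auto
  have "L \<inter> K = {0}" if "L \<in> F" for L
    using K(1,3) that lagrangianD(1)[OF assms(4)[OF that]] subspace_0 by fast
  then show ?thesis using K by (auto simp: lagrangian_def)
qed

section \<open>Projections along a common complement\<close>

text \<open>
  \<open>M\<close> and \<open>K\<close> are subspaces whose direct sum is the whole space.
\<close>

definition complementary :: "'a::euclidean_space set \<Rightarrow> 'a set \<Rightarrow> bool" where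
  "complementary M K \<longleftrightarrow> subspace M \<and> subspace K \<and> M \<inter> K = {0} \<and> dim M + dim K = DIM('a)"

text \<open>
  The projection onto \<open>M\<close> along \<open>K\<close>. It is meaningful when \<open>M\<close> and \<open>K\<close> are complementary, and
  is then linear on the whole space, unlike the chart map \<open>graph_map\<close>, which is \<open>undefined\<close>
  outside its domain.
\<close>

definition proj_along :: "'a::euclidean_space set \<Rightarrow> 'a set \<Rightarrow> 'a \<Rightarrow> 'a" where
  "proj_along M K x = (THE z. z \<in> M \<and> x - z \<in> K)"

lemma complementary_lagrangian:
  "lagrangian \<omega> M \<Longrightarrow> lagrangian \<omega> K \<Longrightarrow> M \<inter> K = {0} \<Longrightarrow> complementary M K"
  using lagrangianD[of \<omega> M] lagrangianD[of \<omega> K] by (auto simp: complementary_def)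

lemma proj_along_eqI:
  assumes "complementary M K" "z \<in> M" "x - z \<in> K"
  shows "proj_along M K x = z"
  unfolding proj_along_def
proof (rule the_equality)
  show "z \<in> M \<and> x - z \<in> K" using assms by simp
  fix y assume y: "y \<in> M \<and> x - y \<in> K"
  have "y - z \<in> M" using y assms by (auto simp: complementary_def intro: subspace_diff)
  moreover have "(x - z) - (x - y) \<in> K"
    using y assms(1,3) unfolding complementary_def by (blast intro: subspace_diff)
  ultimately have "y - z \<in> M \<inter> K" by simp
  then have "y - z = 0" using assms(1) unfolding complementary_def by blast
  then show "y = z" by simp
qed

lemma
  fixes M :: "'a::euclidean_space set"
  assumes "complementary M K"
  shows proj_along_in: "proj_along M K x \<in> M"
    and proj_along_diff_in: "x - proj_along M K x \<in> K"
proof -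
  have "dim {x + y |x y. x \<in> M \<and> y \<in> K} = dim (UNIV :: 'a set)"
    using dim_sums_trivial_Int[of M K] assms by (simp add: complementary_def)
  then have "{x + y |x y. x \<in> M \<and> y \<in> K} = UNIV"
    using subspace_dim_equal[OF subspace_sums[of M K] subspace_UNIV] assms
    by (simp add: complementary_def)
  then have "x \<in> {x + y |x y. x \<in> M \<and> y \<in> K}" by simp
  then obtain z y where "z \<in> M" "y \<in> K" "x = z + y" by blast
  then have z: "z \<in> M" "x - z \<in> K" by auto
  then show "proj_along M K x \<in> M" "x - proj_along M K x \<in> K"
    using proj_along_eqI[OF assms z] by auto
qed

lemma linear_proj_along:
  assumes "complementary M K"
  shows "linear (proj_along M K)"
proof (rule linearI)
  have sub: "subspace M" "subspace K" using assms by (auto simp: complementary_def)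
  note pin = proj_along_in[OF assms] and pdiff = proj_along_diff_in[OF assms]
  fix x y :: 'a and c :: real
  have "(x - proj_along M K x) + (y - proj_along M K y) \<in> K"
    using pdiff subspace_add[OF sub(2)] by blast
  then show "proj_along M K (x + y) = proj_along M K x + proj_along M K y"
    by (intro proj_along_eqI[OF assms] subspace_add[OF sub(1)] pin) (simp add: algebra_simps)
  have "c *\<^sub>R (x - proj_along M K x) \<in> K" using pdiff subspace_mul[OF sub(2)] by blast
  then show "proj_along M K (c *\<^sub>R x) = c *\<^sub>R proj_along M K x"
    by (intro proj_along_eqI[OF assms] subspace_mul[OF sub(1)] pin) (simp add: algebra_simps)
qed

lemma proj_along_id: "complementary M K \<Longrightarrow> x \<in> M \<Longrightarrow> proj_along M K x = x"
  by (rule proj_along_eqI) (auto simp: complementary_def subspace_0)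

text \<open>
  All complements of \<open>K\<close> are identified with the quotient by \<open>K\<close>, and hence with one another,
  by the projections along \<open>K\<close>.
\<close>

lemma proj_along_proj_along:
  assumes "complementary M K" "complementary N K"
  shows "proj_along N K (proj_along M K x) = proj_along N K x"
proof (rule proj_along_eqI[OF assms(2)])
  show "proj_along N K x \<in> N" by (rule proj_along_in[OF assms(2)])
  have "(x - proj_along N K x) - (x - proj_along M K x) \<in> K"
    using proj_along_diff_in[OF assms(1)] proj_along_diff_in[OF assms(2)] assms(1)
    unfolding complementary_def by (blast intro: subspace_diff)
  then show "proj_along M K x - proj_along N K x \<in> K" by simp
qed

lemma
  assumes "complementary M K" "complementary N K"
  shows inj_on_proj_along: "inj_on (proj_along M K) N"
    and proj_along_image: "proj_along M K ` N = M"
proof -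
  have roundtrip: "proj_along N K (proj_along M K x) = x" if "x \<in> N" for x
    using proj_along_proj_along[OF assms] proj_along_id[OF assms(2) that] by simp
  then show "inj_on (proj_along M K) N" by (metis inj_onI)
  have "x \<in> proj_along M K ` N" if "x \<in> M" for x
    using proj_along_proj_along[OF assms(2,1), of x] proj_along_id[OF assms(1) that]
      proj_along_in[OF assms(2)] by (metis imageI)
  then show "proj_along M K ` N = M" using proj_along_in[OF assms(1)] by blast
qed

lemma graph_map_eq_proj_along:
  assumes M: "complementary M K" and L: "complementary L K" and x: "x \<in> M"
  shows "graph_map M K L x = proj_along L K x - x"
proof -
  have sub: "subspace M" "subspace K" using M by (auto simp: complementary_def)
  note lin = linear_proj_along[OF L]
  let ?T = "\<lambda>x\<in>M. proj_along L K x - x"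
  have diff: "proj_along L K x - x \<in> K" for x
    using proj_along_diff_in[OF L, of x] subspace_neg[OF sub(2)] by fastforce
  have "graph_map M K L = ?T"
    unfolding graph_map_def
  proof (rule the_equality, intro conjI ballI allI)
    show "?T \<in> M \<rightarrow>\<^sub>E K" using diff by auto
    show "?T (x + y) = ?T x + ?T y" if "x \<in> M" "y \<in> M" for x y
      using that subspace_add[OF sub(1)] by (simp add: linear_add[OF lin])
    show "?T (c *\<^sub>R x) = c *\<^sub>R ?T x" if "x \<in> M" for c x
      using that subspace_mul[OF sub(1)] by (simp add: linear_scale[OF lin] scaleR_right_diff_distrib)
    show "L = (\<lambda>x. x + ?T x) ` M" using proj_along_image[OF L M] by simp
  next
    fix T assume T: "T \<in> M \<rightarrow>\<^sub>E K \<and>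
      (\<forall>x\<in>M. \<forall>y\<in>M. T (x + y) = T x + T y) \<and>
      (\<forall>c. \<forall>x\<in>M. T (c *\<^sub>R x) = c *\<^sub>R T x) \<and> L = (\<lambda>x. x + T x) ` M"
    show "T = ?T"
    proof
      fix x
      show "T x = ?T x"
      proof (cases "x \<in> M")
        case True
        have "T x \<in> K" using T True by (auto simp: PiE_def)
        then have "x - (x + T x) \<in> K" using subspace_neg[OF sub(2)] by simp
        moreover have "x + T x \<in> L" using T True by blast
        ultimately have "proj_along L K x = x + T x" using proj_along_eqI[OF L] by blast
        then show ?thesis using True by simp
      next
        case False
        then show ?thesis using T by (auto simp: PiE_def extensional_def)
      qed
    qed
  qed
  then show ?thesis using x by simp
qed

text \<open>
  The chart of \<open>L\<close> centred at \<open>M\<close> with respect to \<open>K\<close>, pulled back along the projection to \<open>M\<close>.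
  For fixed \<open>K\<close> these forms, for different \<open>M\<close> and \<open>L\<close>, all live on the same space.
\<close>

definition proj_form ::
    "('a::euclidean_space \<Rightarrow> 'a \<Rightarrow> real) \<Rightarrow> 'a set \<Rightarrow> 'a set \<Rightarrow> 'a set \<Rightarrow> 'a \<Rightarrow> 'a \<Rightarrow> real" where
  "proj_form \<omega> K M L u v = \<omega> (proj_along L K u) (proj_along M K v)"

text \<open>
  The form is a difference of a term depending on \<open>L\<close> and one depending on \<open>M\<close>. Thus
  \<open>proj_form \<omega> K M L\<close> is antisymmetric in \<open>M\<close> and \<open>L\<close> and additive along chains of Lagrangians.
\<close>

lemma proj_form_eq_diff:
  assumes \<omega>: "symplectic_form \<omega>" and K: "lagrangian \<omega> K"
    and M: "lagrangian \<omega> M" "M \<inter> K = {0}" and L: "lagrangian \<omega> L" "L \<inter> K = {0}"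
  shows "proj_form \<omega> K M L u v = \<omega> (proj_along L K u) v - \<omega> (proj_along M K u) v"
proof -
  note bil = symplectic_form_bilinear[OF \<omega>]
  have cM: "complementary M K" and cL: "complementary L K"
    using complementary_lagrangian assms by blast+
  let ?d = "proj_along L K u - proj_along M K u"
  have "(u - proj_along M K u) - (u - proj_along L K u) \<in> K"
    using proj_along_diff_in[OF cM] proj_along_diff_in[OF cL] lagrangianD(1)[OF K] subspace_diff by blast
  then have "?d \<in> K" by simp
  then have "\<omega> ?d (v - proj_along M K v) = 0"
    using lagrangianD(3)[OF K] proj_along_diff_in[OF cM] by blast
  moreover have "\<omega> (proj_along M K u) (proj_along M K v) = 0"
    using lagrangianD(3)[OF M(1)] proj_along_in[OF cM] by blast
  ultimately show ?thesis
    by (simp add: proj_form_def bilinear_lsub[OF bil] bilinear_rsub[OF bil])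
qed

lemma sym_bilinear_proj_form:
  assumes \<omega>: "symplectic_form \<omega>" and K: "lagrangian \<omega> K"
    and M: "lagrangian \<omega> M" "M \<inter> K = {0}" and L: "lagrangian \<omega> L" "L \<inter> K = {0}"
  shows "sym_bilinear (proj_form \<omega> K M L)"
proof -
  note bil = symplectic_form_bilinear[OF \<omega>]
  have cM: "complementary M K" and cL: "complementary L K"
    using complementary_lagrangian assms by blast+
  have "bilinear (proj_form \<omega> K M L)"
    unfolding bilinear_def linear_iff proj_form_def
    by (simp add: linear_add[OF linear_proj_along] linear_scale[OF linear_proj_along] cM cL
        bilinear_ladd[OF bil] bilinear_radd[OF bil] bilinear_lmul[OF bil] bilinear_rmul[OF bil])
  moreover have "proj_form \<omega> K M L u v = proj_form \<omega> K M L v u" for u v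
  proof -
    have "proj_form \<omega> K M L u v = - proj_form \<omega> K L M u v"
      using proj_form_eq_diff[OF \<omega> K M L] proj_form_eq_diff[OF \<omega> K L M] by simp
    also have "\<dots> = proj_form \<omega> K M L v u"
      unfolding proj_form_def by (subst symplectic_form_skew[OF \<omega>]) simp
    finally show ?thesis .
  qed
  ultimately show ?thesis by (simp add: sym_bilinear_def)
qed

lemma form_coindex_chart:
  assumes \<omega>: "symplectic_form \<omega>" and K: "lagrangian \<omega> K"
    and M: "lagrangian \<omega> M" "M \<inter> K = {0}" and L: "lagrangian \<omega> L" "L \<inter> K = {0}"
    and N: "complementary N K"
  shows "form_coindex M (chart \<omega> M K L) = form_coindex N (proj_form \<omega> K M L)"
proof -
  note bil = symplectic_form_bilinear[OF \<omega>]
  have cM: "complementary M K" and cL: "complementary L K"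
    using complementary_lagrangian assms by blast+
  have "chart \<omega> M K L (proj_along M K x) (proj_along M K x) = proj_form \<omega> K M L x x" for x
  proof -
    have "\<omega> (proj_along M K x) (proj_along M K x) = 0" by (rule symplectic_form_self[OF \<omega>])
    then show ?thesis
      using graph_map_eq_proj_along[OF cM cL proj_along_in[OF cM]] proj_along_proj_along[OF cM cL]
      by (simp add: chart_def proj_form_def bilinear_lsub[OF bil])
  qed
  then have "form_coindex (proj_along M K ` N) (chart \<omega> M K L) = form_coindex N (proj_form \<omega> K M L)"
    using N by (intro form_coindex_linear_image linear_proj_along[OF cM] inj_on_proj_along[OF cM N])
      (auto simp: complementary_def)
  then show ?thesis by (simp add: proj_along_image[OF cM N])
qed

lemma dim_kernel_proj_form:
  assumes \<omega>: "symplectic_form \<omega>" and K: "lagrangian \<omega> K"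
    and M: "lagrangian \<omega> M" "M \<inter> K = {0}" and L: "lagrangian \<omega> L" "L \<inter> K = {0}"
    and N: "complementary N K"
  shows "dim {x \<in> N. \<forall>y\<in>N. proj_form \<omega> K M L x y = 0} = dim (M \<inter> L)"
proof -
  have cM: "complementary M K" and cL: "complementary L K"
    using complementary_lagrangian assms by blast+
  let ?A = "{x \<in> N. \<forall>y\<in>N. proj_form \<omega> K M L x y = 0}"
  have ker: "proj_along L K x \<in> M \<longleftrightarrow> (\<forall>y\<in>N. proj_form \<omega> K M L x y = 0)" for x
  proof
    assume "proj_along L K x \<in> M"
    then show "\<forall>y\<in>N. proj_form \<omega> K M L x y = 0"
      using lagrangianD(3)[OF M(1)] proj_along_in[OF cM] by (auto simp: proj_form_def)
  next
    assume "\<forall>y\<in>N. proj_form \<omega> K M L x y = 0"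
    then have "\<forall>z\<in>proj_along M K ` N. \<omega> (proj_along L K x) z = 0"
      by (auto simp: proj_form_def)
    then have "\<omega> z (proj_along L K x) = 0" if "z \<in> M" for z
      using that symplectic_form_skew[OF \<omega>, of z] by (simp add: proj_along_image[OF cM N])
    then show "proj_along L K x \<in> M" by (rule lagrangian_maximal_isotropic[OF \<omega> M(1)])
  qed
  have A_eq: "?A = N \<inter> proj_along L K -` M" by (auto simp: ker)
  have "proj_along L K ` ?A = proj_along L K ` N \<inter> M" unfolding A_eq by auto
  moreover have "subspace ?A"
    unfolding A_eq using N cM linear_proj_along[OF cL]
    by (simp add: complementary_def subspace_inter linear_subspace_vimage)
  then have "dim (proj_along L K ` ?A) = dim ?A"
    by (rule dim_linear_image_inj[OF linear_proj_along[OF cL]])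
      (rule inj_on_subset[OF inj_on_proj_along[OF cL N]], blast)
  ultimately show ?thesis by (simp add: proj_along_image[OF cL N] Int_commute)
qed

section \<open>The Kashiwara form\<close>

text \<open>
  A bilinear form whose quadratic form, on the product of three Lagrangians, is the
  one defining the Kashiwara index, \<open>\<omega> x y + \<omega> y z + \<omega> z x\<close>. It is not symmetric, but the coindex
  only uses the quadratic form.
\<close>

definition kashiwara_form ::
    "('a::euclidean_space \<Rightarrow> 'a \<Rightarrow> real) \<Rightarrow> 'a \<times> 'a \<times> 'a \<Rightarrow> 'a \<times> 'a \<times> 'a \<Rightarrow> real" where
  "kashiwara_form \<omega> = (\<lambda>(x, y, z) (x', y', z'). \<omega> z x' + \<omega> x y' + \<omega> y z')"

text \<open>
  The left-hand side does not mention \<open>K\<close>. The three forms on the right have sum zero, so that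
  the substitution \<open>(a + b, b + c, a + c)\<close> cancels all mixed terms in the Kashiwara form.
\<close>

lemma form_coindex_kashiwara:
  fixes \<omega> :: "'a::euclidean_space \<Rightarrow> 'a \<Rightarrow> real"
  assumes \<omega>: "symplectic_form \<omega>" and K: "lagrangian \<omega> K"
    and L0: "lagrangian \<omega> L0" "L0 \<inter> K = {0}" and L1: "lagrangian \<omega> L1" "L1 \<inter> K = {0}"
    and L: "lagrangian \<omega> L" "L \<inter> K = {0}" and N: "complementary N K"
  shows "form_coindex (L0 \<times> L1 \<times> L) (kashiwara_form \<omega>) = form_coindex N (proj_form \<omega> K L0 L)
    + form_coindex N (proj_form \<omega> K L1 L0) + form_coindex N (proj_form \<omega> K L L1)"
proof -
  have c0: "complementary L0 K" and c1: "complementary L1 K" and c: "complementary L K"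
    using complementary_lagrangian assms by blast+
  have sN: "subspace N" using N by (simp add: complementary_def)
  define A where "A = proj_form \<omega> K L0 L"
  define B where "B = proj_form \<omega> K L1 L0"
  define C where "C = proj_form \<omega> K L L1"
  have sA: "sym_bilinear A" and sB: "sym_bilinear B" and sC: "sym_bilinear C"
    unfolding A_def B_def C_def using assms by (blast intro: sym_bilinear_proj_form)+
  note bA = sym_bilinearD(1)[OF sA] and bB = sym_bilinearD(1)[OF sB]
  \<comment> \<open>the cocycle identity\<close>
  have zero: "C u v = - A u v - B u v" for u v
    unfolding A_def B_def C_def using proj_form_eq_diff[OF \<omega> K] L0 L1 L by simp
  define D where "D = (\<lambda>p q :: 'a \<times> 'a \<times> 'a.
    A (fst p) (fst q) + (B (fst (snd p)) (fst (snd q)) + C (snd (snd p)) (snd (snd q))))"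
  define g where "g p = (proj_along L0 K (fst p + fst (snd p)),
    proj_along L1 K (fst (snd p) + snd (snd p)), proj_along L K (fst p + snd (snd p)))" for p
  note lin = linear_proj_along[OF c0] linear_proj_along[OF c1] linear_proj_along[OF c]
  have "linear g"
    by (rule linearI) (simp_all add: g_def linear_add[OF lin(1)] linear_add[OF lin(2)]
        linear_add[OF lin(3)] linear_scale[OF lin(1)] linear_scale[OF lin(2)]
        linear_scale[OF lin(3)] algebra_simps)
  have inj: "inj_on g (N \<times> N \<times> N)"
  proof (rule inj_onI)
    fix p q assume pq: "p \<in> N \<times> N \<times> N" "q \<in> N \<times> N \<times> N" "g p = g q"
    obtain a b c a' b' c' where [simp]: "p = (a, b, c)" "q = (a', b', c')" by (metis prod_cases3)
    have N': "a + b \<in> N" "b + c \<in> N" "a + c \<in> N" "a' + b' \<in> N" "b' + c' \<in> N" "a' + c' \<in> N"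
      using pq sN by (auto intro: subspace_add)
    have eqs: "proj_along L0 K (a + b) = proj_along L0 K (a' + b')"
      "proj_along L1 K (b + c) = proj_along L1 K (b' + c')"
      "proj_along L K (a + c) = proj_along L K (a' + c')"
      using pq(3) by (simp_all add: g_def)
    have sums: "a + b = a' + b'" "b + c = b' + c'" "a + c = a' + c'"
      by (rule inj_onD[OF inj_on_proj_along[OF c0 N] eqs(1) N'(1,4)]
          inj_onD[OF inj_on_proj_along[OF c1 N] eqs(2) N'(2,5)]
          inj_onD[OF inj_on_proj_along[OF \<open>complementary L K\<close> N] eqs(3) N'(3,6)])+
    have "(a + b) + (a + c) - (b + c) = (a' + b') + (a' + c') - (b' + c')" using sums by simp
    then have "2 *\<^sub>R a = 2 *\<^sub>R a'" by (simp add: scaleR_2)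
    then have "a = a'" by simp
    then show "p = q" using sums by simp
  qed
  have "g ` (N \<times> N \<times> N) = L0 \<times> L1 \<times> L"
  proof (intro equalityI subsetI)
    fix q assume "q \<in> g ` (N \<times> N \<times> N)"
    then show "q \<in> L0 \<times> L1 \<times> L"
      using proj_along_in[OF c0] proj_along_in[OF c1] proj_along_in[OF c] by (auto simp: g_def)
  next
    fix q assume "q \<in> L0 \<times> L1 \<times> L"
    then obtain x y z where q: "q = (x, y, z)" "x \<in> L0" "y \<in> L1" "z \<in> L" by (metis mem_Sigma_iff prod_cases3)
    obtain u where u: "u \<in> N" "x = proj_along L0 K u"
      using q(2) proj_along_image[OF c0 N] by (metis imageE)
    obtain v where v: "v \<in> N" "y = proj_along L1 K v"
      using q(3) proj_along_image[OF c1 N] by (metis imageE)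
    obtain w where w: "w \<in> N" "z = proj_along L K w"
      using q(4) proj_along_image[OF c N] by (metis imageE)
    define a where "a = (1/2) *\<^sub>R (u + w - v)"
    define b where "b = (1/2) *\<^sub>R (u + v - w)"
    define d where "d = (1/2) *\<^sub>R (v + w - u)"
    have "a + b = (1/2) *\<^sub>R (2 *\<^sub>R u)" "b + d = (1/2) *\<^sub>R (2 *\<^sub>R v)" "a + d = (1/2) *\<^sub>R (2 *\<^sub>R w)"
      unfolding a_def b_def d_def scaleR_2 scaleR_right_distrib[symmetric] by (simp_all add: algebra_simps)
    then have "g (a, b, d) = q" by (simp add: g_def q u v w)
    moreover have "a \<in> N" "b \<in> N" "d \<in> N"
      unfolding a_def b_def d_def using u(1) v(1) w(1) sN
      by (auto intro!: subspace_mul subspace_add subspace_diff)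
    ultimately show "q \<in> g ` (N \<times> N \<times> N)" by force
  qed
  moreover have "form_coindex (g ` (N \<times> N \<times> N)) (kashiwara_form \<omega>) = form_coindex (N \<times> N \<times> N) D"
  proof (rule form_coindex_linear_image[OF \<open>linear g\<close> inj])
    show "subspace (N \<times> N \<times> N)" using sN by (simp add: subspace_Times)
    fix p :: "'a \<times> 'a \<times> 'a"
    obtain a b c where [simp]: "p = (a, b, c)" by (metis prod_cases3)
    have "kashiwara_form \<omega> (g p) (g p) = A (a + c) (a + b) + B (a + b) (b + c) + C (b + c) (a + c)"
      by (simp add: kashiwara_form_def g_def A_def B_def C_def proj_form_def)
    also have "\<dots> = D p p"
      using sym_bilinearD(2)[OF sA, of c a] sym_bilinearD(2)[OF sA, of b a] sym_bilinearD(2)[OF sA, of c b]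
        sym_bilinearD(2)[OF sB, of c a] sym_bilinearD(2)[OF sB, of b a] sym_bilinearD(2)[OF sB, of c b]
      by (simp add: D_def zero bilinear_ladd[OF bA] bilinear_radd[OF bA]
          bilinear_ladd[OF bB] bilinear_radd[OF bB])
    finally show "kashiwara_form \<omega> (g p) (g p) = D p p" .
  qed
  moreover have "form_coindex (N \<times> N \<times> N) D
      = form_coindex N A + (form_coindex N B + form_coindex N C)"
    unfolding D_def
    using form_coindex_direct_sum[OF sA sym_bilinear_direct_sum[OF sB sC] sN subspace_Times[OF sN sN]]
      form_coindex_direct_sum[OF sB sC sN sN] by simp
  ultimately show ?thesis by (simp add: A_def B_def C_def)
qed

text \<open>
  The potential of the difference of the two Maslov indices. The last summand is half the
  dimension of the symplectic space, and so the same for all Lagrangians \<open>L\<close>.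
\<close>

definition coindex_defect ::
    "('a::euclidean_space \<Rightarrow> 'a \<Rightarrow> real) \<Rightarrow> 'a set \<Rightarrow> 'a set \<Rightarrow> 'a set \<Rightarrow> int" where
  "coindex_defect \<omega> L0 L1 L =
     int (form_coindex (L0 \<times> L1 \<times> L) (kashiwara_form \<omega>)) + int (dim (L1 \<inter> L)) - int (dim L)"

text \<open>
  The difference of the coindices in the charts centred at \<open>L0\<close> and \<open>L1\<close> is the defect up to a
  constant that depends on \<open>K\<close> but not on \<open>L\<close>. In terms of the forms on \<open>L\<close> obtained from \<open>K\<close>,
  the defect is \<open>n\<^sub>+(B) - n\<^sub>+(B - C) + n\<^sub>+(- C)\<close>, where \<open>B\<close> and \<open>C\<close> come from the pairs
  \<open>L0, L\<close> and \<open>L0, L1\<close>; the bounds express subadditivity of the coindex.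
\<close>

lemma chart_coindex_diff:
  assumes \<omega>: "symplectic_form \<omega>" and K: "lagrangian \<omega> K"
    and L0: "lagrangian \<omega> L0" "L0 \<inter> K = {0}" and L1: "lagrangian \<omega> L1" "L1 \<inter> K = {0}"
    and L: "lagrangian \<omega> L" "L \<inter> K = {0}"
  shows "int (form_coindex L0 (chart \<omega> L0 K L)) - int (form_coindex L1 (chart \<omega> L1 K L))
      = coindex_defect \<omega> L0 L1 L - int (form_coindex L1 (chart \<omega> L1 K L0))"
    and "0 \<le> coindex_defect \<omega> L0 L1 L"
    and "coindex_defect \<omega> L0 L1 L \<le> int (dim L) - int (dim (L0 \<inter> L1))"
proof -
  have c: "complementary L K" using complementary_lagrangian L K by blast
  have sL: "subspace L" by (rule lagrangianD(1)[OF L(1)])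
  note chart = form_coindex_chart[OF \<omega> K _ _ _ _ c]
  note diff = proj_form_eq_diff[OF \<omega> K]
  let ?h = "\<lambda>M M'. form_coindex L (proj_form \<omega> K M M')"
  have flip: "proj_form \<omega> K M' M = (\<lambda>u v. - proj_form \<omega> K M M' u v)"
    if "lagrangian \<omega> M" "M \<inter> K = {0}" "lagrangian \<omega> M'" "M' \<inter> K = {0}" for M M'
    using diff[OF that] diff[OF that(3,4,1,2)] by (intro ext) simp
  \<comment> \<open>Sylvester's law trades \<open>n\<^sub>+(B - C)\<close> for \<open>n\<^sub>+(C - B)\<close>, which occurs in the Kashiwara form.\<close>
  have sylvester: "?h L1 L + ?h L L1 + dim (L1 \<inter> L) = dim L"
    using form_coindex_uminus_add_eq[OF sym_bilinear_proj_form[OF \<omega> K L1 L] sL]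
    unfolding flip[OF L1 L, symmetric] dim_kernel_proj_form[OF \<omega> K L1 L c] .
  have kashiwara: "form_coindex (L0 \<times> L1 \<times> L) (kashiwara_form \<omega>) = ?h L0 L + ?h L1 L0 + ?h L L1"
    by (rule form_coindex_kashiwara[OF \<omega> K L0 L1 L c])
  have defect: "coindex_defect \<omega> L0 L1 L = int (?h L0 L) - int (?h L1 L) + int (?h L1 L0)"
    using sylvester unfolding coindex_defect_def kashiwara by simp
  show "int (form_coindex L0 (chart \<omega> L0 K L)) - int (form_coindex L1 (chart \<omega> L1 K L))
      = coindex_defect \<omega> L0 L1 L - int (form_coindex L1 (chart \<omega> L1 K L0))"
    using defect by (simp add: chart L0 L1 L)
  have "proj_form \<omega> K L1 L = (\<lambda>u v. proj_form \<omega> K L0 L u v + proj_form \<omega> K L1 L0 u v)"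
    using diff[OF L1 L] diff[OF L0 L] diff[OF L1 L0] by (intro ext) simp
  then have "?h L1 L \<le> ?h L0 L + ?h L1 L0"
    using form_coindex_add_le[OF sym_bilinear_proj_form[OF \<omega> K L0 L]
        sym_bilinear_proj_form[OF \<omega> K L1 L0] sL] by simp
  then show "0 \<le> coindex_defect \<omega> L0 L1 L" using defect by simp
  have "proj_form \<omega> K L0 L = (\<lambda>u v. proj_form \<omega> K L0 L1 u v + proj_form \<omega> K L1 L u v)"
    using diff[OF L1 L] diff[OF L0 L] diff[OF L0 L1] by (intro ext) simp
  then have "?h L0 L \<le> ?h L0 L1 + ?h L1 L"
    using form_coindex_add_le[OF sym_bilinear_proj_form[OF \<omega> K L0 L1]
        sym_bilinear_proj_form[OF \<omega> K L1 L] sL] by simp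
  moreover have "?h L0 L1 + ?h L1 L0 + dim (L0 \<inter> L1) = dim L"
    using form_coindex_uminus_add_eq[OF sym_bilinear_proj_form[OF \<omega> K L0 L1] sL]
    unfolding flip[OF L0 L1, symmetric] dim_kernel_proj_form[OF \<omega> K L0 L1 c] .
  ultimately show "coindex_defect \<omega> L0 L1 L \<le> int (dim L) - int (dim (L0 \<inter> L1))"
    using defect by simp
qed

section \<open>Paths of Lagrangians\<close>

lemma openin_transverse_lagrangians:
  assumes "lagrangian \<omega> K" "L \<in> transverse_lagrangians \<omega> K"
  shows "openin (lagrangian_topology \<omega>) (transverse_lagrangians \<omega> K)"
proof -
  \<comment> \<open>The subbasic set for \<open>U = UNIV\<close> and the chart centred at \<open>L\<close> is the whole chart domain.\<close>
  have "0 \<in> L"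
    using assms(2) lagrangianD(1) subspace_0 by (auto simp: transverse_lagrangians_def)
  moreover have "transverse_lagrangians \<omega> K = {M \<in> transverse_lagrangians \<omega> K. chart \<omega> L K M 0 0 \<in> UNIV}"
    by simp
  ultimately show ?thesis
    unfolding lagrangian_topology_def using assms open_UNIV
    by (intro topology_generated_by_Basis) blast
qed

lemma lagrangian_path_lagrangian:
  assumes "lagrangian_path \<omega> a b l" "t \<in> {a..b}"
  shows "lagrangian \<omega> (l t)"
proof -
  have "l t \<in> topspace (lagrangian_topology \<omega>)"
    using assms continuous_map_image_subset_topspace
    unfolding lagrangian_path_def by fastforce
  then show ?thesis by (auto simp: lagrangian_topology_def transverse_lagrangians_def)
qed

lemma lagrangian_path_subinterval:
  assumes "lagrangian_path \<omega> a b l" "a \<le> s" "t \<le> b"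
  shows "lagrangian_path \<omega> s t l"
  unfolding lagrangian_path_def
  by (rule continuous_map_from_subtopology_mono[OF assms(1)[unfolded lagrangian_path_def]])
    (use assms in auto)

lemma lagrangian_path_locally_in_chart:
  assumes path: "lagrangian_path \<omega> a b l" and x: "x \<in> {a..b}"
    and K: "lagrangian \<omega> K" "l x \<inter> K = {0}"
  obtains d where "d > 0"
    "\<And>t. t \<in> {a..b} \<Longrightarrow> \<bar>t - x\<bar> < d \<Longrightarrow> l t \<in> transverse_lagrangians \<omega> K"
proof -
  have lx: "l x \<in> transverse_lagrangians \<omega> K"
    using lagrangian_path_lagrangian[OF path x] K by (simp add: transverse_lagrangians_def)
  have "openin (top_of_set {a..b}) {t \<in> {a..b}. l t \<in> transverse_lagrangians \<omega> K}"
    using openin_continuous_map_preimage[OF path[unfolded lagrangian_path_def]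
        openin_transverse_lagrangians[OF K(1) lx]] by simp
  then obtain d where "d > 0"
    "ball x d \<inter> {a..b} \<subseteq> {t \<in> {a..b}. l t \<in> transverse_lagrangians \<omega> K}"
    using x lx unfolding openin_contains_ball by blast
  then show thesis using that[of d] by (auto simp: dist_real_def subset_iff abs_minus_commute)
qed

lemma maslov_index_diff:
  fixes \<omega> :: "'a::euclidean_space \<Rightarrow> 'a \<Rightarrow> real"
  assumes \<omega>: "symplectic_form \<omega>"
    and L0: "lagrangian \<omega> L0" and L1: "lagrangian \<omega> L1"
    and \<mu>0: "is_maslov_index \<omega> L0 \<mu>0" and \<mu>1: "is_maslov_index \<omega> L1 \<mu>1"
    and ab: "a \<le> b" and path: "lagrangian_path \<omega> a b l"
  shows "\<mu>0 a b l - \<mu>1 a b l = coindex_defect \<omega> L0 L1 (l b) - coindex_defect \<omega> L0 L1 (l a)"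
proof -
  define P where "P s t \<longleftrightarrow> (a \<le> s \<longrightarrow> s \<le> t \<longrightarrow> t \<le> b \<longrightarrow>
    \<mu>0 s t l - \<mu>1 s t l = coindex_defect \<omega> L0 L1 (l t) - coindex_defect \<omega> L0 L1 (l s))" for s t
  have "P a b" using ab
  proof (induction rule: Bolzano)
    case (trans r s t)
    show ?case unfolding P_def
    proof (intro impI)
      assume le: "a \<le> r" "r \<le> t" "t \<le> b"
      then have "lagrangian_path \<omega> r t l" using lagrangian_path_subinterval[OF path] by blast
      then have "\<mu>0 r t l = \<mu>0 r s l + \<mu>0 s t l" "\<mu>1 r t l = \<mu>1 r s l + \<mu>1 s t l"
        using \<mu>0 \<mu>1 trans(3,4) unfolding is_maslov_index_def by blast+
      then show "\<mu>0 r t l - \<mu>1 r t l = coindex_defect \<omega> L0 L1 (l t) - coindex_defect \<omega> L0 L1 (l r)"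
        using trans le unfolding P_def by simp
    qed
  next
    case (local x)
    then have x: "x \<in> {a..b}" by simp
    note lx = lagrangian_path_lagrangian[OF path x]
    have "\<exists>K. lagrangian \<omega> K \<and> (\<forall>M\<in>{L0, L1, l x}. M \<inter> K = {0})"
      using L0 L1 lx even_dim_lagrangian[OF L0]
      by (intro exists_common_transverse_lagrangian[OF \<omega>]) auto
    then obtain K where K: "lagrangian \<omega> K" "L0 \<inter> K = {0}" "L1 \<inter> K = {0}" "l x \<inter> K = {0}"
      by auto
    obtain d where d: "d > 0"
      "\<And>t. t \<in> {a..b} \<Longrightarrow> \<bar>t - x\<bar> < d \<Longrightarrow> l t \<in> transverse_lagrangians \<omega> K"
      using lagrangian_path_locally_in_chart[OF path x K(1,4)] by blast
    have "P s t" if st: "s \<le> x" "x \<le> t" "t - s < d" for s t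
      unfolding P_def
    proof (intro impI)
      assume le: "a \<le> s" "s \<le> t" "t \<le> b"
      have sub: "l ` {s..t} \<subseteq> transverse_lagrangians \<omega> K"
        using d(2) st le by auto
      have p: "lagrangian_path \<omega> s t l" using lagrangian_path_subinterval[OF path] le by blast
      have "\<mu> s t l = int (form_coindex M (chart \<omega> M K (l t))) - int (form_coindex M (chart \<omega> M K (l s)))"
        if "is_maslov_index \<omega> M \<mu>" "M \<inter> K = {0}" for \<mu> M
        using that(1)[unfolded is_maslov_index_def, THEN conjunct2, THEN conjunct2, rule_format,
            OF le(2) p K(1) that(2) sub] .
      note this[OF \<mu>0 K(2)] this[OF \<mu>1 K(3)]
      moreover have "l s \<in> transverse_lagrangians \<omega> K" "l t \<in> transverse_lagrangians \<omega> K"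
        using sub le by auto
      then have "lagrangian \<omega> (l s)" "l s \<inter> K = {0}" "lagrangian \<omega> (l t)" "l t \<inter> K = {0}"
        by (auto simp: transverse_lagrangians_def)
      note chart_coindex_diff(1)[OF \<omega> K(1) L0 K(2) L1 K(3) this(1,2)]
        chart_coindex_diff(1)[OF \<omega> K(1) L0 K(2) L1 K(3) this(3,4)]
      ultimately show "\<mu>0 s t l - \<mu>1 s t l
          = coindex_defect \<omega> L0 L1 (l t) - coindex_defect \<omega> L0 L1 (l s)" by linarith
    qed
    then show ?case using d(1) by blast
  qed
  then show ?thesis using ab by (simp add: P_def)
qed

lemma coindex_defect_bounds:
  fixes \<omega> :: "'a::euclidean_space \<Rightarrow> 'a \<Rightarrow> real"
  assumes "symplectic_form \<omega>" "lagrangian \<omega> L0" "lagrangian \<omega> L1" "lagrangian \<omega> L"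
  shows "0 \<le> coindex_defect \<omega> L0 L1 L"
    and "coindex_defect \<omega> L0 L1 L \<le> int (dim L) - int (dim (L0 \<inter> L1))"
proof -
  have "\<exists>K. lagrangian \<omega> K \<and> (\<forall>M\<in>{L0, L1, L}. M \<inter> K = {0})"
    using assms(2-4) even_dim_lagrangian[OF assms(2)]
    by (intro exists_common_transverse_lagrangian[OF assms(1)]) auto
  then obtain K where K: "lagrangian \<omega> K" "L0 \<inter> K = {0}" "L1 \<inter> K = {0}" "L \<inter> K = {0}"
    by auto
  note bounds = chart_coindex_diff(2,3)[OF assms(1) K(1) assms(2) K(2) assms(3) K(3) assms(4) K(4)]
  show "0 \<le> coindex_defect \<omega> L0 L1 L" by (rule bounds(1))
  show "coindex_defect \<omega> L0 L1 L \<le> int (dim L) - int (dim (L0 \<inter> L1))" by (rule bounds(2))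
qed

theorem proposition3p3:
  fixes \<omega> :: "'a::euclidean_space \<Rightarrow> 'a \<Rightarrow> real"
    and n :: nat
    and L0 L1 :: "'a set"
    and \<mu>0 \<mu>1 :: "real \<Rightarrow> real \<Rightarrow> (real \<Rightarrow> 'a set) \<Rightarrow> int"
    and l :: "real \<Rightarrow> 'a set"
    and a b :: real
  assumes "symplectic_form \<omega>" and "DIM('a) = 2 * n"
    and "lagrangian \<omega> L0" and "lagrangian \<omega> L1"
    and "is_maslov_index \<omega> L0 \<mu>0" and "is_maslov_index \<omega> L1 \<mu>1"
    and "a \<le> b" and "lagrangian_path \<omega> a b l"
  shows "\<bar>\<mu>0 a b l - \<mu>1 a b l\<bar> \<le> int n - int (dim (L0 \<inter> L1))"
proof -
  have lag: "lagrangian \<omega> (l a)" "lagrangian \<omega> (l b)"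
    using lagrangian_path_lagrangian[OF assms(8)] assms(7) by auto
  have "dim (l a) = n" "dim (l b) = n"
    using lagrangianD(2)[OF lag(1)] lagrangianD(2)[OF lag(2)] assms(2) by auto
  then show ?thesis
    using maslov_index_diff[OF assms(1,3-8)] coindex_defect_bounds[OF assms(1,3,4) lag(1)]
      coindex_defect_bounds[OF assms(1,3,4) lag(2)] by linarith
qed

end
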